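(* If a discrete random variable (with values in $\{0,1,2,\dots\}$) is a geometric($p$) sum of its own D-type for two values of $p$, say $p_1$ and $p_2$, such that $\log p_1/\log p_2$ is irrational, then it is $\mathrm{DML}(\lambda,\alpha)$.
   Context: A geometric($p$) variable has probability generating function $ps/(1-qs)$, $q=1-p$. Two probability generating functions $P_1,P_2$ are of the same D-type if and only if $P_1(1-s)=P_2(1-cs)$ for all $0<s<1$ and some $0<c<1$, equivalently $P_1(u)=P_2(1-c+cu)$. A random variable $X$ with probability generating function $P$ is a geometric($p$) sum of its own D-type if $X\stackrel{d}{=}\sum_{i=1}^{N}X_i$, where the $X_i$ are i.i.d. with probability generating function $s\mapsto P(1-b+bs)$ for some $0<b<1$, and $N$ is a geometric($p$) variable independent of them. A random variable is $\mathrm{DML}(\lambda,\alpha)$ (discrete Mittag-Leffler) if its probability generating function is $[1+\lambda(1-s)^\alpha]^{-1}$, $\lambda>0$, $0<\alpha\le 1$.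
   Formalization: The random variable is additionally assumed not to be almost surely 0: the constant 0 is a geometric(p) sum of its own D-type for every p but is not DML(λ,α) for any λ>0. *)

theory Defs
  imports "HOL-Probability.Probability"
begin

definition pgf :: "'a measure \<Rightarrow> ('a \<Rightarrow> nat) \<Rightarrow> real \<Rightarrow> real" where
  "pgf M X s = (\<integral>\<omega>. s ^ X \<omega> \<partial>M)"

text \<open>The support is \<open>{1, 2, \<dots>}\<close>, in contrast to the library's \<open>geometric_pmf\<close>.\<close>

definition geometric_var :: "'a measure \<Rightarrow> ('a \<Rightarrow> nat) \<Rightarrow> real \<Rightarrow> bool" where
  "geometric_var M N p \<longleftrightarrow>
     0 < p \<and> p < 1 \<and> (\<forall>s\<in>{0..1}. pgf M N s = p * s / (1 - (1 - p) * s))"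

text \<open>
  The random variable \<open>X\<close> on \<open>M\<close> is a geometric(\<open>p\<close>) sum of its own D-type, the summands
  \<open>Y 1, Y 2, \<dots>\<close> and the number \<open>N\<close> of summands living on an auxiliary probability space \<open>M'\<close>.
  The entry \<open>Y 0\<close> is not a summand: it is overwritten by \<open>N\<close> in order to state the joint
  independence of \<open>N, Y 1, Y 2, \<dots>\<close> as that of one family.
  The auxiliary space is a parameter because its type cannot be quantified existentially.
\<close>

definition geometric_sum_own_D_type ::
  "'a measure \<Rightarrow> ('a \<Rightarrow> nat) \<Rightarrow> real \<Rightarrow> 'b measure \<Rightarrow> ('b \<Rightarrow> nat) \<Rightarrow> (nat \<Rightarrow> 'b \<Rightarrow> nat) \<Rightarrow> bool" where
  "geometric_sum_own_D_type M X p M' N Y \<longleftrightarrow>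
     prob_space M' \<and>
     prob_space.indep_vars M' (\<lambda>_. count_space UNIV) (Y(0 := N)) UNIV \<and>
     geometric_var M' N p \<and>
     (\<exists>b. 0 < b \<and> b < 1 \<and>
       (\<forall>i\<ge>1. \<forall>s\<in>{0..1}. pgf M' (Y i) s = pgf M X (1 - b + b * s))) \<and>
     distr M (count_space UNIV) X =
       distr M' (count_space UNIV) (\<lambda>\<omega>. \<Sum>i=1..N \<omega>. Y i \<omega>)"

definition DML :: "'a measure \<Rightarrow> ('a \<Rightarrow> nat) \<Rightarrow> real \<Rightarrow> real \<Rightarrow> bool" where
  "DML M X c \<alpha> \<longleftrightarrow>
     0 < c \<and> 0 < \<alpha> \<and> \<alpha> \<le> 1 \<and>
     (\<forall>s\<in>{0..1}. pgf M X s = inverse (1 + c * (1 - s) powr \<alpha>))"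

end

theory Submission
  imports Defs "HOL-Real_Asymp.Real_Asymp"
begin

text \<open>
  Let \<open>P\<close> be the generating function of \<open>X\<close> and \<open>\<phi> u = 1 / P (1 - u) - 1\<close>. Conditioning on the
  number of summands turns the hypotheses into \<open>\<phi> (b\<^sub>i * u) = p\<^sub>i * \<phi> u\<close>. Hence
  \<open>\<psi> t = ln (\<phi> (exp (- t)))\<close> is a decreasing function on the half-line with
  \<open>\<psi> (t + \<beta>\<^sub>i) = \<psi> t - \<pi>\<^sub>i\<close>, where \<open>\<beta>\<^sub>i = - ln b\<^sub>i\<close> and \<open>\<pi>\<^sub>i = - ln p\<^sub>i\<close>. Monotonicity forces
  \<open>\<pi>\<^sub>1 / \<beta>\<^sub>1 = \<pi>\<^sub>2 / \<beta>\<^sub>2\<close>; call this number \<open>\<alpha>\<close>. By the density of \<open>\<beta>\<^sub>1 \<nat> - \<beta>\<^sub>2 \<nat>\<close> the function \<open>\<psi> t + \<alpha> * t\<close> is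
  constant, so \<open>\<phi> u = \<phi> 1 * u powr \<alpha>\<close>. Finally \<open>\<alpha> \<le> 1\<close> since \<open>1 - P (1 - u)\<close> is at least a
  positive multiple of \<open>u\<close>.
\<close>

section \<open>Decreasing functions with two incommensurable quasi-periods\<close>

text \<open>Density of fractional parts gives integers \<open>h\<close>, \<open>k\<close> with
  \<open>k > 0\<close> but \<open>h\<close> of unknown sign. Moving the target by
  \<open>j * \<theta>\<close> until it is nonnegative forces \<open>h > 0\<close>.\<close>

lemma nat_multiples_dense_mod:
  fixes \<theta> x e :: real
  assumes "\<theta> \<notin> \<rat>" "0 < \<theta>" "0 < e"
  obtains m n :: nat where "0 \<le> real n - real m * \<theta> - x" "real n - real m * \<theta> - x \<le> e"
proof -
  obtain j :: nat where j: "- x / \<theta> < real j"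
    using reals_Archimedean2 by blast
  define y where "y = real j * \<theta> + x"
  have y: "0 \<le> y"
    using j \<open>0 < \<theta>\<close> by (simp add: y_def field_simps)
  \<comment> \<open>Aiming \<open>e / 2\<close> below \<open>- y\<close> turns the two-sided bound
    into \<open>0 < h - k * \<theta> - y < e\<close>.\<close>
  obtain h k :: int where k: "k > 0" and hk: "\<bar>of_int k * \<theta> - of_int h - (- y - e / 2)\<bar> < e / 2"
    using sequence_of_fractional_parts_is_dense[OF \<open>\<theta> \<notin> \<rat>\<close>] \<open>0 < e\<close> by (metis half_gt_zero)
  have "0 < of_int h - of_int k * \<theta> - y" "of_int h - of_int k * \<theta> - y < e"
    using hk by (auto simp: abs_if split: if_splits)
  moreover have "0 < of_int k * \<theta>"
    using k \<open>0 < \<theta>\<close> by simp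
  ultimately have "h > 0"
    using y by (smt (verit) of_int_0_less_iff)
  show thesis
  proof
    show "0 \<le> real (nat h) - real (j + nat k) * \<theta> - x" "real (nat h) - real (j + nat k) * \<theta> - x \<le> e"
      using \<open>0 < of_int h - of_int k * \<theta> - y\<close> \<open>of_int h - of_int k * \<theta> - y < e\<close> k \<open>h > 0\<close>
      by (simp_all add: y_def algebra_simps)
  qed
qed

lemma quasi_periodic_iterate:
  fixes \<psi> :: "real \<Rightarrow> real"
  assumes "\<And>t. 0 \<le> t \<Longrightarrow> \<psi> (t + \<beta>) = \<psi> t - \<pi>" "0 \<le> \<beta>" "0 \<le> t"
  shows "\<psi> (t + real m * \<beta>) = \<psi> t - real m * \<pi>"
proof (induction m)
  case (Suc m)
  have "\<psi> (t + real (Suc m) * \<beta>) = \<psi> ((t + real m * \<beta>) + \<beta>)"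
    by (simp add: algebra_simps)
  also have "\<dots> = \<psi> (t + real m * \<beta>) - \<pi>"
    using assms by simp
  finally show ?case
    using Suc by (simp add: algebra_simps)
qed simp

text \<open>If a rational \<open>m / n\<close> separated the two ratios, \<open>m\<close> steps of
  \<open>\<beta>2\<close> would reach at least as far as \<open>n\<close> steps of
  \<open>\<beta>1\<close> and yet lower \<open>\<psi>\<close> by less, against monotonicity.\<close>

lemma quasi_period_ratio_le:
  fixes \<psi> :: "real \<Rightarrow> real"
  assumes mono: "\<And>s t. 0 \<le> s \<Longrightarrow> s \<le> t \<Longrightarrow> \<psi> t \<le> \<psi> s"
    and "\<And>t. 0 \<le> t \<Longrightarrow> \<psi> (t + \<beta>1) = \<psi> t - \<pi>1" "\<And>t. 0 \<le> t \<Longrightarrow> \<psi> (t + \<beta>2) = \<psi> t - \<pi>2"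
    and "0 < \<beta>1" "0 < \<beta>2" "0 < \<pi>1" "0 < \<pi>2"
  shows "\<pi>1 / \<pi>2 \<le> \<beta>1 / \<beta>2"
proof (rule ccontr)
  assume "\<not> \<pi>1 / \<pi>2 \<le> \<beta>1 / \<beta>2"
  then obtain r where r: "r \<in> \<rat>" "\<beta>1 / \<beta>2 < r" "r < \<pi>1 / \<pi>2"
    using Rats_dense_in_real[of "\<beta>1 / \<beta>2" "\<pi>1 / \<pi>2"] by force
  have "0 < r"
    using r(2) assms(4,5) by (smt (verit) divide_pos_pos)
  then obtain m n :: nat where n: "r = real m / real n" "n \<noteq> 0"
    using r(1) by (metis Rats_abs_nat_div_natE abs_of_pos)
  have "real n * \<beta>1 \<le> real m * \<beta>2" "real m * \<pi>2 < real n * \<pi>1"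
    using r n assms(4-) by (simp_all add: field_simps)
  moreover have "\<psi> (0 + real m * \<beta>2) \<le> \<psi> (0 + real n * \<beta>1)"
    using \<open>real n * \<beta>1 \<le> real m * \<beta>2\<close> \<open>0 < \<beta>1\<close> by (intro mono) auto
  moreover have "\<psi> (0 + real n * \<beta>1) = \<psi> 0 - real n * \<pi>1" "\<psi> (0 + real m * \<beta>2) = \<psi> 0 - real m * \<pi>2"
    using assms by (auto intro!: quasi_periodic_iterate simp del: add_0_left)
  ultimately show False
    by linarith
qed

lemma incommensurable_quasi_periods_imp_affine:
  fixes \<psi> :: "real \<Rightarrow> real"
  assumes mono: "\<And>s t. 0 \<le> s \<Longrightarrow> s \<le> t \<Longrightarrow> \<psi> t \<le> \<psi> s"
    and per1: "\<And>t. 0 \<le> t \<Longrightarrow> \<psi> (t + \<beta>1) = \<psi> t - \<pi>1"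
    and per2: "\<And>t. 0 \<le> t \<Longrightarrow> \<psi> (t + \<beta>2) = \<psi> t - \<pi>2"
    and pos: "0 < \<beta>1" "0 < \<beta>2" "0 < \<pi>1" "0 < \<pi>2"
    and irr: "\<pi>1 / \<pi>2 \<notin> \<rat>"
    and "0 \<le> t"
  shows "\<psi> t = \<psi> 0 - \<pi>1 / \<beta>1 * t"
proof -
  define \<alpha> where "\<alpha> = \<pi>1 / \<beta>1"
  have ratio: "\<pi>1 / \<pi>2 = \<beta>1 / \<beta>2"
    using quasi_period_ratio_le[of \<psi> \<beta>1 \<pi>1 \<beta>2 \<pi>2] quasi_period_ratio_le[of \<psi> \<beta>2 \<pi>2 \<beta>1 \<pi>1] assms
    by (simp add: field_simps)
  have \<alpha>: "\<pi>1 = \<alpha> * \<beta>1" "\<pi>2 = \<alpha> * \<beta>2" "0 < \<alpha>"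
    using ratio pos by (auto simp: \<alpha>_def field_simps)
  \<comment> \<open>Both shifts preserve \<open>\<psi> t + \<alpha> * t\<close>. Since
    \<open>x\<close> and \<open>y\<close> are arbitrary, exchanging them turns this single
    inequality into constancy.\<close>
  have le: "\<psi> y + \<alpha> * y \<le> \<psi> x + \<alpha> * x" if xy: "0 \<le> x" "0 \<le> y" for x y
  proof (rule field_le_epsilon)
    fix e :: real assume "0 < e"
    \<comment> \<open>The numbers are chosen so that \<open>y + n * \<beta>2\<close> lies to the
      right of \<open>x + m * \<beta>1\<close> by at most \<open>e / \<alpha>\<close>; everything is
      divided by \<open>\<beta>2\<close> to fit the density lemma.\<close>
    obtain m n :: nat
      where "0 \<le> real n - real m * (\<beta>1 / \<beta>2) - (x - y) / \<beta>2"
        and "real n - real m * (\<beta>1 / \<beta>2) - (x - y) / \<beta>2 \<le> e / (\<alpha> * \<beta>2)"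
      using nat_multiples_dense_mod[of "\<beta>1 / \<beta>2" "e / (\<alpha> * \<beta>2)" "(x - y) / \<beta>2"]
        irr ratio pos \<open>0 < e\<close> \<open>0 < \<alpha>\<close> by (metis divide_pos_pos mult_pos_pos)
    moreover have "real n - real m * (\<beta>1 / \<beta>2) - (x - y) / \<beta>2 = (y + real n * \<beta>2 - (x + real m * \<beta>1)) / \<beta>2"
      using pos by (simp add: field_simps)
    moreover have "e / (\<alpha> * \<beta>2) = (e / \<alpha>) / \<beta>2"
      by simp
    ultimately have d: "0 \<le> y + real n * \<beta>2 - (x + real m * \<beta>1)"
        "y + real n * \<beta>2 - (x + real m * \<beta>1) \<le> e / \<alpha>"
      using pos by (simp_all only: divide_le_cancel zero_le_divide_iff) linarith+
    then have 1: "x + real m * \<beta>1 \<le> y + real n * \<beta>2"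
      and 2: "\<alpha> * (y + real n * \<beta>2) \<le> \<alpha> * (x + real m * \<beta>1) + e"
      using pos \<open>0 < \<alpha>\<close> by (simp_all add: field_simps)
    have "\<psi> (y + real n * \<beta>2) \<le> \<psi> (x + real m * \<beta>1)"
      using 1 xy pos by (intro mono) auto
    then show "\<psi> y + \<alpha> * y \<le> \<psi> x + \<alpha> * x + e"
      using 2 quasi_periodic_iterate[of \<psi> \<beta>1 \<pi>1 x m] quasi_periodic_iterate[of \<psi> \<beta>2 \<pi>2 y n]
        per1 per2 xy pos
      by (simp add: \<alpha> algebra_simps)
  qed
  show ?thesis
    using le[of 0 t] le[of t 0] \<open>0 \<le> t\<close> by (simp add: \<alpha>_def)
qed

section \<open>Probability generating functions\<close>

lemma measurable_add_nat:
  fixes f g :: "'a \<Rightarrow> nat"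
  assumes [measurable]: "f \<in> measurable M (count_space UNIV)" "g \<in> measurable M (count_space UNIV)"
  shows "(\<lambda>x. f x + g x) \<in> measurable M (count_space UNIV)"
  by (rule measurable_compose_countable[where g = f]) (auto intro: measurable_compose[OF assms(2)])

context prob_space
begin

lemma integrable_power_nat:
  fixes s :: real
  assumes [measurable]: "X \<in> measurable M (count_space UNIV)" and "0 \<le> s" "s \<le> 1"
  shows "integrable M (\<lambda>\<omega>. s ^ X \<omega>)"
  by (rule integrable_const_bound[of _ 1]) (use assms in \<open>auto simp: power_le_one\<close>)

lemma pgf_1: "pgf M X 1 = 1"
  by (simp add: pgf_def prob_space)

lemma pgf_nonneg: "0 \<le> s \<Longrightarrow> 0 \<le> pgf M X s"
  by (simp add: pgf_def)

lemma pgf_mono: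
  assumes "X \<in> measurable M (count_space UNIV)" "0 \<le> s" "s \<le> t" "t \<le> 1"
  shows "pgf M X s \<le> pgf M X t"
  unfolding pgf_def using assms by (intro integral_mono integrable_power_nat power_mono) auto

lemma pgf_le_1:
  assumes "X \<in> measurable M (count_space UNIV)" "0 \<le> s" "s \<le> 1"
  shows "pgf M X s \<le> 1"
  using pgf_mono[OF assms(1,2,3)] by (simp add: pgf_1)

lemma pgf_pos:
  assumes "X \<in> measurable M (count_space UNIV)" "0 < s" "s \<le> 1"
  shows "0 < pgf M X s"
proof -
  have "pgf M X s \<noteq> 0"
  proof
    assume "pgf M X s = 0"
    then have "AE \<omega> in M. s ^ X \<omega> = 0"
      unfolding pgf_def using assms
      by (subst (asm) integral_nonneg_eq_0_iff_AE) (auto intro: integrable_power_nat)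
    then show False
      using \<open>0 < s\<close> by simp
  qed
  then show ?thesis
    using pgf_nonneg[of s X] assms by simp
qed

text \<open>Pointwise, \<open>s ^ k\<close> is 1 for \<open>k = 0\<close> and at most
  \<open>s\<close> otherwise. If \<open>X\<close> is not almost surely 0, this keeps the generating
  function below 1 on \<open>[0, 1)\<close>, and it later forces
  \<open>\<alpha> \<le> 1\<close>.\<close>

lemma pgf_le_linear:
  assumes [measurable]: "X \<in> measurable M (count_space UNIV)" and "0 \<le> s" "s \<le> 1"
  shows "pgf M X s \<le> 1 - (1 - s) * prob {\<omega> \<in> space M. X \<omega> \<noteq> 0}"
proof -
  let ?A = "{\<omega> \<in> space M. X \<omega> \<noteq> 0}"
  have int: "integrable M (\<lambda>\<omega>. (1 - s) * indicator ?A \<omega>)"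
    by (intro integrable_mult_right integrable_real_indicator) (auto simp: less_top[symmetric])
  have "pgf M X s \<le> (\<integral>\<omega>. 1 - (1 - s) * indicator ?A \<omega> \<partial>M)"
    unfolding pgf_def
  proof (rule integral_mono)
    fix \<omega> assume "\<omega> \<in> space M"
    then show "s ^ X \<omega> \<le> 1 - (1 - s) * indicator ?A \<omega>"
      using assms power_decreasing[of 1 "X \<omega>" s] by (cases "X \<omega> = 0") auto
  next
    show "integrable M (\<lambda>\<omega>. 1 - (1 - s) * indicator ?A \<omega>)"
      using int by simp
  qed (use assms in \<open>auto intro!: integrable_power_nat\<close>)
  also have "\<dots> = 1 - (1 - s) * prob ?A"
    by (subst Bochner_Integration.integral_diff[OF _ int]) (simp_all add: prob_space)
  finally show ?thesis .
qed

text \<open>On each event \<open>N = n\<close>, independence replaces the \<open>n\<close> factors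
  \<open>s ^ Y i\<close> by their common mean \<open>z\<close>; summing over \<open>n\<close> gives
  the claim.\<close>

lemma pgf_random_sum:
  fixes N :: "'a \<Rightarrow> nat" and Y :: "nat \<Rightarrow> 'a \<Rightarrow> nat"
  assumes indep: "indep_vars (\<lambda>_. count_space UNIV) (Y(0 := N)) UNIV"
    and pgf_Y: "\<And>i. i \<ge> 1 \<Longrightarrow> pgf M (Y i) s = z"
    and s: "0 \<le> s" "s \<le> 1"
  shows "pgf M (\<lambda>\<omega>. \<Sum>i=1..N \<omega>. Y i \<omega>) s = pgf M N z"
    and "(\<lambda>\<omega>. \<Sum>i=1..N \<omega>. Y i \<omega>) \<in> measurable M (count_space UNIV)"
proof -
  have meas: "(Y(0 := N)) i \<in> measurable M (count_space UNIV)" for i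
    using indep by (auto simp: indep_vars_def2)
  have N[measurable]: "N \<in> measurable M (count_space UNIV)"
    using meas[of 0] by simp
  have Y: "Y i \<in> measurable M (count_space UNIV)" if "i \<ge> 1" for i
    using meas[of i] that by simp
  have S: "(\<lambda>\<omega>. \<Sum>i=1..n. Y i \<omega>) \<in> measurable M (count_space UNIV)" for n
    by (induction n) (auto intro!: measurable_add_nat Y)
  show SN[measurable]: "(\<lambda>\<omega>. \<Sum>i=1..N \<omega>. Y i \<omega>) \<in> measurable M (count_space UNIV)"
    by (rule measurable_compose_countable[OF S]) simp
  have z: "0 \<le> z" "z \<le> 1"
    using pgf_Y[of 1] pgf_nonneg[of s "Y 1"] pgf_le_1[OF Y[of 1] s] s by auto
  define A where "A n = {\<omega> \<in> space M. N \<omega> = n}" for n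
  have [measurable]: "A n \<in> sets M" for n
    unfolding A_def by measurable
  have UN: "(\<Union>n. A n) = space M"
    by (auto simp: A_def)
  have eq: "(LINT \<omega>:A n|M. s ^ (\<Sum>i=1..N \<omega>. Y i \<omega>)) = (LINT \<omega>:A n|M. z ^ N \<omega>)" for n
  proof -
    \<comment> \<open>Coordinate 0 carries \<open>N\<close>, so \<open>f 0\<close> is the indicator
      of the event and the other \<open>f i\<close> are the powers: one product over
      \<open>{0..n}\<close> exploits the joint independence.\<close>
    define f where "f i k = (if i = 0 then indicator {n} k else s ^ k)" for i k :: nat
    have f: "integrable M (\<lambda>\<omega>. f i ((Y(0 := N)) i \<omega>))" for i
      by (rule integrable_const_bound[of _ 1])
         (use s meas[of i] in \<open>auto simp: f_def power_le_one indicator_def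
            intro!: measurable_compose[OF meas[of i]]\<close>)
    have "indep_vars (\<lambda>_. borel) (\<lambda>i \<omega>. f i ((Y(0 := N)) i \<omega>)) {0..n}"
      by (rule indep_vars_compose2[OF indep_vars_subset[OF indep]]) auto
    then have "(\<integral>\<omega>. (\<Prod>i=0..n. f i ((Y(0 := N)) i \<omega>)) \<partial>M)
        = (\<Prod>i=0..n. \<integral>\<omega>. f i ((Y(0 := N)) i \<omega>) \<partial>M)"
      by (intro indep_vars_lebesgue_integral f) auto
    also have "\<dots> = (\<integral>\<omega>. indicator {n} (N \<omega>) \<partial>M) * (\<Prod>i=1..n. z)"
      by (subst prod.atLeast_Suc_atMost)
         (auto simp: f_def pgf_Y[unfolded pgf_def] simp del: prod_constant intro!: prod.cong)
    also have "\<dots> = (\<integral>\<omega>. indicator {n} (N \<omega>) * z ^ n \<partial>M)"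
      by simp
    also have "\<dots> = (LINT \<omega>:A n|M. z ^ N \<omega>)"
      unfolding set_lebesgue_integral_def
      by (rule Bochner_Integration.integral_cong) (auto simp: A_def indicator_def)
    also have "(\<integral>\<omega>. (\<Prod>i=0..n. f i ((Y(0 := N)) i \<omega>)) \<partial>M)
        = (LINT \<omega>:A n|M. s ^ (\<Sum>i=1..N \<omega>. Y i \<omega>))"
      unfolding set_lebesgue_integral_def
    proof (rule Bochner_Integration.integral_cong[OF refl])
      fix \<omega> assume "\<omega> \<in> space M"
      have "(\<Prod>i=0..n. f i ((Y(0 := N)) i \<omega>)) = indicator {n} (N \<omega>) * (\<Prod>i=1..n. s ^ Y i \<omega>)"
        by (subst prod.atLeast_Suc_atMost) (auto simp: f_def intro!: prod.cong)
      then show "(\<Prod>i=0..n. f i ((Y(0 := N)) i \<omega>))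
          = indicat_real (A n) \<omega> *\<^sub>R s ^ (\<Sum>i=1..N \<omega>. Y i \<omega>)"
        using \<open>\<omega> \<in> space M\<close> by (auto simp: A_def indicator_def power_sum)
    qed
    finally show ?thesis .
  qed
  have split: "(\<integral>\<omega>. g \<omega> \<partial>M) = (\<Sum>n. LINT \<omega>:A n|M. g \<omega>)" if "integrable M g" for g :: "'a \<Rightarrow> real"
  proof -
    have "(LINT \<omega>:(\<Union>n. A n)|M. g \<omega>) = (\<Sum>n. LINT \<omega>:A n|M. g \<omega>)"
      using that by (intro lebesgue_integral_countable_add)
        (auto simp: UN set_integrable_def simp del: real_scaleR_def
          intro!: integrable_mult_indicator, auto simp: A_def)
    then show ?thesis
      using that by (simp add: UN set_integral_space)
  qed
  show "pgf M (\<lambda>\<omega>. \<Sum>i=1..N \<omega>. Y i \<omega>) s = pgf M N z"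
    unfolding pgf_def
    by (simp only: split eq integrable_power_nat[OF SN s] integrable_power_nat[OF N z])
qed

end

lemma pgf_distr:
  assumes "X \<in> measurable M (count_space UNIV)"
  shows "pgf M X s = (\<integral>k. s ^ k \<partial>distr M (count_space UNIV) X)"
  unfolding pgf_def using assms by (subst integral_distr) auto

section \<open>The functional equation\<close>

text \<open>The map \<open>z \<mapsto> p * z / (1 - (1 - p) * z)\<close> acts on
  \<open>1 / z - 1\<close> as division by \<open>p\<close>, so geometric compounding becomes linear.
  For a DML law this function is \<open>c * u powr \<alpha>\<close> on
  \<open>[0, 1]\<close>.\<close>

definition pgf_odds :: "'a measure \<Rightarrow> ('a \<Rightarrow> nat) \<Rightarrow> real \<Rightarrow> real" where
  "pgf_odds M X u = 1 / pgf M X (1 - u) - 1"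

text \<open>\<open>X\<close> and the random sum live on different spaces but have the same law,
  hence the same generating function; for the sum it is that of \<open>N\<close> at the value taken
  by the summands.\<close>

lemma geometric_sum_own_D_type_imp_pgf:
  assumes "X \<in> measurable M (count_space UNIV)"
    and "geometric_sum_own_D_type M X p M' N Y"
  obtains b where "0 < p" "p < 1" "0 < b" "b < 1"
    and "\<And>s. 0 \<le> s \<Longrightarrow> s \<le> 1 \<Longrightarrow>
      pgf M X s = p * pgf M X (1 - b + b * s) / (1 - (1 - p) * pgf M X (1 - b + b * s))"
proof -
  obtain b where b: "0 < b" "b < 1"
    and Y: "\<And>i s. i \<ge> 1 \<Longrightarrow> 0 \<le> s \<Longrightarrow> s \<le> 1 \<Longrightarrow> pgf M' (Y i) s = pgf M X (1 - b + b * s)"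
    using assms(2) unfolding geometric_sum_own_D_type_def by auto
  interpret M': prob_space M'
    using assms(2) unfolding geometric_sum_own_D_type_def by auto
  have indep: "M'.indep_vars (\<lambda>_. count_space UNIV) (Y(0 := N)) UNIV"
    and geo: "geometric_var M' N p"
    and distr: "distr M (count_space UNIV) X =
      distr M' (count_space UNIV) (\<lambda>\<omega>. \<Sum>i=1..N \<omega>. Y i \<omega>)"
    using assms(2) unfolding geometric_sum_own_D_type_def by auto
  have Y1: "Y 1 \<in> measurable M' (count_space UNIV)"
    using indep by (auto simp: M'.indep_vars_def2 dest: spec[of _ 1])
  show thesis
  proof
    show "0 < p" "p < 1"
      using geo by (auto simp: geometric_var_def)
    fix s :: real assume s: "0 \<le> s" "s \<le> 1"
    define z where "z = pgf M X (1 - b + b * s)"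
    have sum: "pgf M' (\<lambda>\<omega>. \<Sum>i=1..N \<omega>. Y i \<omega>) s = pgf M' N z"
      "(\<lambda>\<omega>. \<Sum>i=1..N \<omega>. Y i \<omega>) \<in> measurable M' (count_space UNIV)"
      by (rule M'.pgf_random_sum[OF indep _ s, of z]; use Y s z_def in simp)+
    \<comment> \<open>The closed form for \<open>N\<close> is given only on the unit
      interval.\<close>
    have "z \<in> {0..1}"
      using Y[of 1 s] s M'.pgf_nonneg[of s "Y 1"] M'.pgf_le_1[OF Y1 s] by (simp add: z_def)
    moreover have "pgf M X s = pgf M' N z"
      using sum by (simp add: pgf_distr assms(1) distr flip: sum(1))
    ultimately show "pgf M X s = p * pgf M X (1 - b + b * s) / (1 - (1 - p) * pgf M X (1 - b + b * s))"
      using geo by (simp add: geometric_var_def z_def)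
  qed (use b in auto)
qed

section \<open>Scaling of the odds and the range of the exponent for nondegenerate variables\<close>

context
  fixes M :: "'a measure" and X :: "'a \<Rightarrow> nat"
  assumes prob: "prob_space M"
    and meas: "X \<in> measurable M (count_space UNIV)"
    and nonzero: "\<not> (AE \<omega> in M. X \<omega> = 0)"
begin

interpretation prob_space M by (rule prob)

text \<open>For \<open>X = 0\<close> almost surely the odds vanish identically, which would
  correspond to \<open>c = 0\<close>. This probability is the positive slope in the linear bound on
  the generating function.\<close>

lemma prob_nonzero_pos: "0 < prob {\<omega> \<in> space M. X \<omega> \<noteq> 0}"
proof -
  have "{\<omega> \<in> space M. X \<omega> \<noteq> 0} \<in> events"
    using meas by simp
  then have "prob {\<omega> \<in> space M. X \<omega> \<noteq> 0} \<noteq> 0"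
    using nonzero by (simp add: prob_eq_0 AE_iff_measurable)
  then show ?thesis
    by (simp add: zero_less_measure_iff)
qed

lemma pgf_less_1: "0 \<le> s \<Longrightarrow> s < 1 \<Longrightarrow> pgf M X s < 1"
  using pgf_le_linear[OF meas, of s] prob_nonzero_pos
  by (smt (verit) mult_pos_pos)

text \<open>Self-decomposability excludes \<open>P(X = 0) = 0\<close>, which would make \<^const>\<open>pgf_odds\<close> meaningless at \<open>1\<close>.\<close>

lemma geometric_sum_pgf_pos:
  assumes "geometric_sum_own_D_type M X p M' N Y" "0 \<le> s" "s \<le> 1"
  shows "0 < pgf M X s"
proof -
  obtain b where pb: "0 < p" "p < 1" "0 < b" "b < 1"
    and eq: "\<And>s. 0 \<le> s \<Longrightarrow> s \<le> 1 \<Longrightarrow>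
      pgf M X s = p * pgf M X (1 - b + b * s) / (1 - (1 - p) * pgf M X (1 - b + b * s))"
    using geometric_sum_own_D_type_imp_pgf[OF meas assms(1)] by blast
  let ?z = "pgf M X (1 - b + b * s)"
  \<comment> \<open>Even at \<open>s = 0\<close> the argument is \<open>1 - b > 0\<close>, where
    positivity is automatic; the functional equation carries it back to \<open>s\<close>.\<close>
  have "1 - b + b * s \<le> 1" "0 < 1 - b + b * s"
    using pb assms by (auto simp: mult_left_le add_pos_nonneg)
  then have z: "0 < ?z" "?z \<le> 1"
    using meas by (auto intro: pgf_pos pgf_le_1)
  have "(1 - p) * ?z < 1"
    using z pb by (smt (verit) mult_left_le)
  then show ?thesis
    using eq[OF assms(2,3)] z pb by simp
qed

lemma pgf_odds_scaling:
  assumes "geometric_sum_own_D_type M X p M' N Y"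
  obtains b where "0 < p" "p < 1" "0 < b" "b < 1"
    and "\<And>u. 0 \<le> u \<Longrightarrow> u \<le> 1 \<Longrightarrow> pgf_odds M X (b * u) = p * pgf_odds M X u"
proof -
  obtain b where pb: "0 < p" "p < 1" "0 < b" "b < 1"
    and eq: "\<And>s. 0 \<le> s \<Longrightarrow> s \<le> 1 \<Longrightarrow>
      pgf M X s = p * pgf M X (1 - b + b * s) / (1 - (1 - p) * pgf M X (1 - b + b * s))"
    using geometric_sum_own_D_type_imp_pgf[OF meas assms] by blast
  have "pgf_odds M X (b * u) = p * pgf_odds M X u" if u: "0 \<le> u" "u \<le> 1" for u
  proof -
    let ?z = "pgf M X (1 - b * u)"
    have "0 \<le> b * u" "b * u \<le> 1"
      using u pb by (auto simp: mult_le_one)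
    \<comment> \<open>With \<open>1 / 0 = 0\<close>, a vanishing \<open>?z\<close> would give odds
      \<open>-1\<close> on both sides of the scaling, so positivity matters.\<close>
    then have z: "0 < ?z"
      by (intro geometric_sum_pgf_pos[OF assms]) auto
    have "1 - b + b * (1 - u) = 1 - b * u"
      by (simp add: algebra_simps)
    then have "pgf M X (1 - u) = p * ?z / (1 - (1 - p) * ?z)"
      using eq[of "1 - u"] u by (metis diff_ge_0_iff_ge diff_le_eq le_add_same_cancel1)
    then show ?thesis
      using z pb by (simp add: pgf_odds_def field_simps)
  qed
  then show thesis
    using that pb by blast
qed

lemma DML_if_pgf_odds_powr:
  assumes pos: "\<And>s. 0 \<le> s \<Longrightarrow> s \<le> 1 \<Longrightarrow> 0 < pgf M X s"
    and "0 < c" "0 < \<alpha>"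
    and odds: "\<And>u. 0 < u \<Longrightarrow> u \<le> 1 \<Longrightarrow> pgf_odds M X u = c * u powr \<alpha>"
  shows "DML M X c \<alpha>"
proof -
  have eq: "pgf M X s = inverse (1 + c * (1 - s) powr \<alpha>)" if "0 \<le> s" "s \<le> 1" for s
  \<comment> \<open>The formula for the odds covers only \<open>u > 0\<close>; at
    \<open>s = 1\<close> both sides are 1 because \<open>0 powr \<alpha> = 0\<close>.\<close>
  proof (cases "s = 1")
    case False
    then have "(1 + c * (1 - s) powr \<alpha>) * pgf M X s = 1"
      using odds[of "1 - s"] pos[OF that] that by (simp add: pgf_odds_def field_simps)
    then show ?thesis
      by (rule inverse_unique[symmetric])
  qed (simp add: pgf_1)
  have "\<alpha> \<le> 1"
  proof (rule ccontr)
    assume "\<not> \<alpha> \<le> 1"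
    let ?\<pi> = "prob {\<omega> \<in> space M. X \<omega> \<noteq> 0}"
    have le: "?\<pi> \<le> c * u powr (\<alpha> - 1)" if u: "0 < u" "u \<le> 1" for u
    proof -
      have "u * ?\<pi> \<le> 1 - pgf M X (1 - u)"
        using pgf_le_linear[OF meas, of "1 - u"] u by simp
      also have "\<dots> \<le> pgf_odds M X u"
      proof -
        define x where "x = pgf M X (1 - u)"
        have "0 < x"
          unfolding x_def using u by (intro pos) auto
        then have "1 / x - 1 - (1 - x) = (1 - x)\<^sup>2 / x"
          by (simp add: field_simps power2_eq_square)
        then show ?thesis
          using \<open>0 < x\<close> by (simp add: pgf_odds_def flip: x_def)
            (smt (verit) divide_nonneg_pos zero_le_power2)
      qed
      also have "\<dots> = u * (c * u powr (\<alpha> - 1))"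
        using odds[OF u] u by (simp add: powr_diff)
      finally show ?thesis
        using u by simp
    qed
    \<comment> \<open>For \<open>\<alpha> > 1\<close> the upper bound on the fixed positive
      \<open>?\<pi>\<close> tends to 0 as \<open>u\<close> decreases to 0.\<close>
    have "((\<lambda>u. c * u powr (\<alpha> - 1)) \<longlongrightarrow> c * 0) (at_right 0)"
      using \<open>\<not> \<alpha> \<le> 1\<close> by (intro tendsto_mult tendsto_const) real_asymp
    moreover have "eventually (\<lambda>u. ?\<pi> \<le> c * u powr (\<alpha> - 1)) (at_right 0)"
      using eventually_at_right_real[of 0 "1 :: real"]
      by (rule eventually_mono) (simp_all add: le del: neq0_conv)
    ultimately have "?\<pi> \<le> c * 0"
      by (rule tendsto_lowerbound) simp
    then show False
      using prob_nonzero_pos by simp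
  qed
  then show ?thesis
    using assms eq by (simp add: DML_def)
qed

end

section \<open>Passage to the logarithmic scale\<close>

theorem theorem5p2:
  fixes M :: "'a measure" and X :: "'a \<Rightarrow> nat"
    and M1 :: "'b measure" and N1 :: "'b \<Rightarrow> nat" and Y1 :: "nat \<Rightarrow> 'b \<Rightarrow> nat"
    and M2 :: "'c measure" and N2 :: "'c \<Rightarrow> nat" and Y2 :: "nat \<Rightarrow> 'c \<Rightarrow> nat"
    and p1 p2 :: real
  assumes "prob_space M"
    and "X \<in> measurable M (count_space UNIV)"
    and "\<not> (AE \<omega> in M. X \<omega> = 0)"
    and "geometric_sum_own_D_type M X p1 M1 N1 Y1"
    and "geometric_sum_own_D_type M X p2 M2 N2 Y2"
    and "ln p1 / ln p2 \<notin> \<rat>"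
  shows "\<exists>c \<alpha>. DML M X c \<alpha>"
proof -
  interpret prob_space M by fact
  obtain b1 where 1: "0 < p1" "p1 < 1" "0 < b1" "b1 < 1"
    and scale1: "\<And>u. 0 \<le> u \<Longrightarrow> u \<le> 1 \<Longrightarrow> pgf_odds M X (b1 * u) = p1 * pgf_odds M X u"
    using pgf_odds_scaling[OF assms(1-4)] by blast
  obtain b2 where 2: "0 < p2" "p2 < 1" "0 < b2" "b2 < 1"
    and scale2: "\<And>u. 0 \<le> u \<Longrightarrow> u \<le> 1 \<Longrightarrow> pgf_odds M X (b2 * u) = p2 * pgf_odds M X u"
    using pgf_odds_scaling[OF assms(1-3,5)] by blast
  have pos: "0 < pgf M X s" if "0 \<le> s" "s \<le> 1" for s
    using geometric_sum_pgf_pos[OF assms(1-4) that] .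
  have odds_pos: "0 < pgf_odds M X u" if "0 < u" "u \<le> 1" for u
    using pos[of "1 - u"] pgf_less_1[OF assms(1-3), of "1 - u"] that by (simp add: pgf_odds_def)
  have odds_mono: "pgf_odds M X u \<le> pgf_odds M X v" if "0 \<le> u" "u \<le> v" "v \<le> 1" for u v
    using pgf_mono[OF assms(2), of "1 - v" "1 - u"] pos[of "1 - v"] that
    by (simp add: pgf_odds_def frac_le)
  \<comment> \<open>The half-line \<open>t \<ge> 0\<close> corresponds to
    \<open>0 < u \<le> 1\<close>, where the odds are positive and \<open>ln\<close> is
    meaningful.\<close>
  define \<psi> where "\<psi> t = ln (pgf_odds M X (exp (- t)))" for t
  define \<alpha> where "\<alpha> = - ln p1 / - ln b1"
  have shift: "\<psi> (t + - ln b) = \<psi> t - - ln p"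
    if "0 \<le> t" "0 < p" "0 < b"
      "\<And>u. 0 \<le> u \<Longrightarrow> u \<le> 1 \<Longrightarrow> pgf_odds M X (b * u) = p * pgf_odds M X u" for t b p
  proof -
    have "exp (- (t + - ln b)) = b * exp (- t)"
      using that by (simp add: exp_add exp_diff exp_minus field_simps)
    then show ?thesis
      using that odds_pos[of "exp (- t)"] by (simp add: \<psi>_def ln_mult)
  qed
  have affine: "\<psi> t = \<psi> 0 - \<alpha> * t" if "0 \<le> t" for t
    unfolding \<alpha>_def
  proof (rule incommensurable_quasi_periods_imp_affine[of \<psi> "- ln b1" "- ln p1" "- ln b2" "- ln p2"])
    show "\<psi> t \<le> \<psi> s" if "0 \<le> s" "s \<le> t" for s t
      unfolding \<psi>_def using that by (intro ln_mono odds_mono odds_pos) auto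
    show "\<psi> (t + - ln b1) = \<psi> t - - ln p1" if "0 \<le> t" for t
      using that 1 scale1 by (intro shift) auto
    show "\<psi> (t + - ln b2) = \<psi> t - - ln p2" if "0 \<le> t" for t
      using that 2 scale2 by (intro shift) auto
  qed (use 1 2 assms(6) that in auto)
  \<comment> \<open>The constant is the value at \<open>u = 1\<close>, that is
    \<open>exp (\<psi> 0)\<close>; the affine formula at \<open>t = - ln u\<close> gives the power
    law.\<close>
  have "DML M X (pgf_odds M X 1) \<alpha>"
  proof (rule DML_if_pgf_odds_powr[OF assms(1-3) pos odds_pos])
    fix u :: real assume u: "0 < u" "u \<le> 1"
    have "ln (pgf_odds M X u) = ln (pgf_odds M X 1) + \<alpha> * ln u"
      using affine[of "- ln u"] u by (simp add: \<psi>_def)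
    then have "exp (ln (pgf_odds M X u)) = pgf_odds M X 1 * exp (\<alpha> * ln u)"
      using odds_pos[of 1] by (simp add: exp_add)
    then show "pgf_odds M X u = pgf_odds M X 1 * u powr \<alpha>"
      using odds_pos[OF u] u by (simp add: powr_def)
  qed (use 1 in \<open>auto simp: \<alpha>_def divide_neg_neg\<close>)
  then show ?thesis
    by blast
qed

end
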